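(* Let $J\ge 3$. The subfamily of models $\{(\text{sequential},F,Z);\ F\in\tilde{\mathfrak{F}},\ Z\in\mathfrak{Z}\}$ is stable under the transposition $\tilde{\tau}$ of the last two categories (the permutation of $\{1,\dots,J\}$ exchanging $J-1$ and $J$).
   Context: Setting. Let $J\ge 3$ (number of categories), $p\ge 1$, and let $\mathcal{X}\subseteq\mathbb{R}^p$ be the nonempty set of values of the explanatory vector $x$. Let $\mathcal{M}=\{\pi\in\,]0,1[^{J-1} : \sum_{j=1}^{J-1}\pi_j<1\}$; for $\pi\in\mathcal{M}$ put $\pi_J=1-\sum_{j=1}^{J-1}\pi_j$ ($\pi_j$ is the probability of category $j$). Ratio. The sequential ratio $r:\mathcal{M}\to\,]0,1[^{J-1}$ is $r_j(\pi)=\pi_j/(\pi_j+\dots+\pi_J)$, $j=1,\dots,J-1$; it is a bijection onto $]0,1[^{J-1}$. Cdfs. $\tilde{\mathfrak{F}}$ is the set of continuous cumulative distribution functions $F$ on $\mathbb{R}$ that are strictly increasing on the open interval $I_F=\{w: 0<F(w)<1\}$ (so that $F$ maps $I_F$ bijectively onto $]0,1[$) and symmetric, i.e. $F(w)=1-F(-w)$ for all $w$. Design matrices. The complete design matrix $Z_c(x)$ is the $(J-1)\times(J-1)(1+p)$ matrix with $Z_c(x)\beta=(\alpha_j+x^t\delta_j)_{j=1,\dots,J-1}$ for $\beta=(\alpha_1,\dots,\alpha_{J-1},\delta_1^t,\dots,\delta_{J-1}^t)^t$, $\alpha_j\in\mathbb{R}$, $\delta_j\in\mathbb{R}^p$.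 The set $\mathfrak{Z}$ of design matrices consists of all matrix functions $Z:x\mapsto Z_c(x)C$, where $C$ is a constant real matrix of full column rank with $q$ columns, $J-1+p\le q\le (J-1)(1+p)$. Models. A model $(r,F,Z)$, with $Z$ having $q$ columns, has as parameter space the set of $\beta\in\mathbb{R}^q$ such that for all $x\in\mathcal{X}$, $\eta=Z(x)\beta$ satisfies $\eta\in I_F^{J-1}$ and $(F(\eta_1),\dots,F(\eta_{J-1}))\in r(\mathcal{M})$. For such $\beta$ and $x\in\mathcal{X}$, it defines the unique $\pi=\pi(x;\beta)\in\mathcal{M}$ with $r(\pi)=(F(\eta_1),\dots,F(\eta_{J-1}))^t$, $\eta=Z(x)\beta$. Permuted models. For a permutation $\sigma$ of $\{1,\dots,J\}$ and $\pi\in\mathcal{M}$, let $\pi_\sigma=(\pi_{\sigma(1)},\dots,\pi_{\sigma(J-1)})\in\mathcal{M}$. The permuted model $(r,F,Z)_\sigma$ has the same parameter space as $(r,F,Z)$ and defines $\pi=\pi(x;\beta)\in\mathcal{M}$ by $r(\pi_\sigma)=(F(\eta_1),\dots,F(\eta_{J-1}))^t$, $\eta=Z(x)\beta$. Two (possibly permuted) models are equal if they have the same parameter space and give the same $\pi(x;\beta)$ for all $x\in\mathcal{X}$ and all $\beta$ in it. A family of models $\mathfrak{M}$ is stable under $\sigma$ if $\sigma(\mathfrak{M})=\mathfrak{M}$, where $\sigma(\mathfrak{M})=\{(r,F,Z)_\sigma : (r,F,Z)\in\mathfrak{M}\}$ and equal models are identified (i.e. every model of each of the two sets is equal to some model of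 the other). *)

theory Defs
  imports
    "HOL-Probability.Distribution_Functions"
    "HOL-Combinatorics.Transposition"
    "Jordan_Normal_Form.DL_Rank"
begin

text \<open>
  Vectors and matrices are those of \<^theory>\<open>Jordan_Normal_Form.Matrix\<close>, so coordinates are
  numbered from 0. Accordingly the \<open>J\<close> categories are numbered \<open>0, ..., J - 1\<close> instead of
  \<open>1, ..., J\<close>, and permutations of the categories act on \<open>{..<J}\<close>.
\<close>

definition prob_vecs :: "nat \<Rightarrow> real vec set" where
  "prob_vecs J = {\<pi> \<in> carrier_vec (J - 1).
     (\<forall>j<J - 1. 0 < \<pi> $ j \<and> \<pi> $ j < 1) \<and> (\<Sum>j<J - 1. \<pi> $ j) < 1}"

text \<open>The probability of category \<open>j < J\<close>; the last one is not a coordinate of \<open>\<pi>\<close>.\<close>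

definition cat_prob :: "nat \<Rightarrow> real vec \<Rightarrow> nat \<Rightarrow> real" where
  "cat_prob J \<pi> j = (if j < J - 1 then \<pi> $ j else 1 - (\<Sum>i<J - 1. \<pi> $ i))"

definition permute_probs :: "nat \<Rightarrow> (nat \<Rightarrow> nat) \<Rightarrow> real vec \<Rightarrow> real vec" where
  "permute_probs J \<sigma> \<pi> = vec (J - 1) (\<lambda>j. cat_prob J \<pi> (\<sigma> j))"

definition sequential :: "nat \<Rightarrow> real vec \<Rightarrow> real vec" where
  "sequential J \<pi> = vec (J - 1) (\<lambda>j. cat_prob J \<pi> j / (\<Sum>k=j..<J. cat_prob J \<pi> k))"

definition open_support :: "(real \<Rightarrow> real) \<Rightarrow> real set" where
  "open_support F = {w. 0 < F w \<and> F w < 1}"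

definition symmetric_cdfs :: "(real \<Rightarrow> real) set" where
  "symmetric_cdfs = {F. (\<exists>M. real_distribution M \<and> F = cdf M) \<and>
     continuous_on UNIV F \<and> strict_mono_on (open_support F) F \<and> (\<forall>w. F w = 1 - F (- w))}"

text \<open>
  The columns of the complete design matrix are ordered as in
  \<open>\<beta> = (\<alpha>\<^sub>0, ..., \<alpha>\<^bsub>J-2\<^esub>, \<delta>\<^sub>0, ..., \<delta>\<^bsub>J-2\<^esub>)\<close>, each block \<open>\<delta>\<^sub>i\<close> having \<open>p\<close> entries.
\<close>

definition complete_design :: "nat \<Rightarrow> nat \<Rightarrow> real vec \<Rightarrow> real mat" where
  "complete_design J p x = mat (J - 1) ((J - 1) * (1 + p)) (\<lambda>(i, k).
     if k < J - 1 then (if k = i then 1 else 0)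
     else if (k - (J - 1)) div p = i then x $ ((k - (J - 1)) mod p) else 0)"

lemma complete_design_mult_vec:
  assumes "x \<in> carrier_vec p" and "\<beta> \<in> carrier_vec ((J - 1) * (1 + p))" and "j < J - 1"
  shows "(complete_design J p x *\<^sub>v \<beta>) $ j
       = \<beta> $ j + x \<bullet> vec p (\<lambda>l. \<beta> $ (J - 1 + j * p + l))"
proof -
  define m where "m = J - 1"
  have m: "j < m" using assms(3) by (simp add: m_def)
  define f where "f k = (if k div p = j then x $ (k mod p) else 0) * \<beta> $ (k + m)" for k
  have "(complete_design J p x *\<^sub>v \<beta>) $ j
      = (\<Sum>k=0..<m * (1 + p). (if k < m then (if k = j then 1 else 0)
          else if (k - m) div p = j then x $ ((k - m) mod p) else 0) * \<beta> $ k)"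
    using assms unfolding complete_design_def m_def[symmetric] by (simp add: scalar_prod_def)
  also have "\<dots> = (\<Sum>k=0..<m. (if k = j then 1 else 0) * \<beta> $ k) + (\<Sum>k=m..<m + m * p.
        (if (k - m) div p = j then x $ ((k - m) mod p) else 0) * \<beta> $ k)"
    by (subst sum.atLeastLessThan_concat[symmetric, of 0 m])
       (auto intro!: arg_cong2[of _ _ _ _ "(+)"] sum.cong)
  also have "(\<Sum>k=0..<m. (if k = j then 1 else 0) * \<beta> $ k) = \<beta> $ j"
    using m by (simp add: if_distrib[of "\<lambda>c. c * _"] cong: if_cong)
  also have "(\<Sum>k=m..<m + m * p.
        (if (k - m) div p = j then x $ ((k - m) mod p) else 0) * \<beta> $ k) = (\<Sum>k=0..<m * p. f k)"
    using sum.shift_bounds_nat_ivl[of "\<lambda>k. (if (k - m) div p = j then x $ ((k - m) mod p)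
        else 0) * \<beta> $ k" 0 m "m * p"]
    by (simp add: f_def add.commute[of m "m * p"] cong: if_cong)
  also have "\<dots> = (\<Sum>k\<in>(\<lambda>l. j * p + l) ` {0..<p}. f k)"
  proof (rule sum.mono_neutral_right)
    show "(\<lambda>l. j * p + l) ` {0..<p} \<subseteq> {0..<m * p}"
    proof
      fix k assume "k \<in> (\<lambda>l. j * p + l) ` {0..<p}"
      then have "k < Suc j * p" by auto
      also have "\<dots> \<le> m * p" using m by (intro mult_le_mono1) simp
      finally show "k \<in> {0..<m * p}" by simp
    qed
    show "\<forall>k\<in>{0..<m * p} - (\<lambda>l. j * p + l) ` {0..<p}. f k = 0"
    proof
      fix k assume k: "k \<in> {0..<m * p} - (\<lambda>l. j * p + l) ` {0..<p}"
      then have "0 < p" by (cases p) auto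
      have "k div p \<noteq> j"
      proof
        assume "k div p = j"
        then have "k = j * p + k mod p" by (metis div_mult_mod_eq)
        with k \<open>0 < p\<close> show False by (metis DiffD2 atLeast0LessThan imageI lessThan_iff mod_less_divisor)
      qed
      then show "f k = 0" by (simp add: f_def)
    qed
  qed simp
  also have "\<dots> = (\<Sum>l=0..<p. f (j * p + l))"
    by (subst sum.reindex) (auto simp: inj_on_def)
  also have "\<dots> = x \<bullet> vec p (\<lambda>l. \<beta> $ (m + j * p + l))"
    by (auto simp: scalar_prod_def f_def ac_simps intro!: sum.cong)
  finally show ?thesis by (simp add: m_def)
qed

definition designs :: "nat \<Rightarrow> nat \<Rightarrow> (real vec \<Rightarrow> real mat) set" where
  "designs J p = {Z. \<exists>q C. J - 1 + p \<le> q \<and> q \<le> (J - 1) * (1 + p) \<and>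
     C \<in> carrier_mat ((J - 1) * (1 + p)) q \<and>
     vec_space.rank ((J - 1) * (1 + p)) C = q \<and>
     Z = (\<lambda>x. complete_design J p x * C)}"

text \<open>
  A model specification is a triple \<open>(r, F, Z)\<close>. The number of columns of \<open>Z x\<close> does not depend
  on \<open>x\<close> for \<open>Z \<in> designs J p\<close>, so the parameter space below consists of vectors of one
  dimension (\<open>X\<close> being nonempty).
\<close>

type_synonym spec = "(real vec \<Rightarrow> real vec) \<times> (real \<Rightarrow> real) \<times> (real vec \<Rightarrow> real mat)"

definition param_space :: "nat \<Rightarrow> real vec set \<Rightarrow> spec \<Rightarrow> real vec set" where
  "param_space J X = (\<lambda>(r, F, Z). {\<beta>. \<forall>x\<in>X. \<beta> \<in> carrier_vec (dim_col (Z x)) \<and>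
     (\<forall>j<J - 1. (Z x *\<^sub>v \<beta>) $ j \<in> open_support F) \<and>
     map_vec F (Z x *\<^sub>v \<beta>) \<in> r ` prob_vecs J})"

text \<open>
  A model is represented by its parameter space \<open>\<Theta>\<close> together with the map \<open>(x, \<beta>) \<mapsto> \<pi>(x; \<beta>)\<close>
  restricted to \<open>X \<times> \<Theta>\<close>. Hence two models are equal as HOL terms iff they have the same
  parameter space and define the same \<open>\<pi>(x; \<beta>)\<close> for all \<open>x \<in> X\<close> and \<open>\<beta> \<in> \<Theta>\<close>.
\<close>

type_synonym model = "real vec set \<times> (real vec \<times> real vec \<Rightarrow> real vec)"

definition model :: "nat \<Rightarrow> real vec set \<Rightarrow> spec \<Rightarrow> model" where
  "model J X = (\<lambda>(r, F, Z). (param_space J X (r, F, Z),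
     \<lambda>(x, \<beta>) \<in> X \<times> param_space J X (r, F, Z).
       THE \<pi>. \<pi> \<in> prob_vecs J \<and> r \<pi> = map_vec F (Z x *\<^sub>v \<beta>)))"

definition permuted_model :: "nat \<Rightarrow> real vec set \<Rightarrow> (nat \<Rightarrow> nat) \<Rightarrow> spec \<Rightarrow> model" where
  "permuted_model J X \<sigma> = (\<lambda>(r, F, Z). (param_space J X (r, F, Z),
     \<lambda>(x, \<beta>) \<in> X \<times> param_space J X (r, F, Z).
       THE \<pi>. \<pi> \<in> prob_vecs J \<and> r (permute_probs J \<sigma> \<pi>) = map_vec F (Z x *\<^sub>v \<beta>)))"

definition stable_under :: "nat \<Rightarrow> real vec set \<Rightarrow> (nat \<Rightarrow> nat) \<Rightarrow> spec set \<Rightarrow> bool" where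
  "stable_under J X \<sigma> S \<longleftrightarrow> permuted_model J X \<sigma> ` S = model J X ` S"

end

theory Submission
  imports Defs
begin

text \<open>
  Exchanging the last two categories replaces the last sequential ratio \<open>u\<close> by \<open>1 - u\<close> and keeps
  the others. By the symmetry of \<open>F\<close> this amounts to changing the sign of the last linear predictor,
  which is the multiplication of \<open>Z x\<close> on the left by a diagonal sign matrix. That matrix can be
  moved through the complete design, where it becomes an invertible factor of \<open>C\<close>. Since
  the sign change is an involution, both families of models coincide.
\<close>

section \<open>Full column rank and invertible factors\<close>

text \<open>The rank is read off from the set of columns, which forgets repetitions. For distinct
  columns a trivial kernel is linear independence of that set; with a repeated column both sides are
  false.\<close>

lemma (in vec_space) rank_eq_dim_col_iff:
  assumes A: "A \<in> carrier_mat n nc"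
  shows "rank A = nc \<longleftrightarrow> (\<forall>v\<in>carrier_vec nc. A *\<^sub>v v = 0\<^sub>v n \<longrightarrow> v = 0\<^sub>v nc)"
proof (cases "distinct (cols A)")
  case True
  show ?thesis
  proof
    assume "rank A = nc"
    then have "lin_indpt (set (cols A))"
      using full_rank_lin_indpt[OF A _ True] by simp
    then show "\<forall>v\<in>carrier_vec nc. A *\<^sub>v v = 0\<^sub>v n \<longrightarrow> v = 0\<^sub>v nc"
      using lin_depI[OF A _ _ _ True] by blast
  next
    assume "\<forall>v\<in>carrier_vec nc. A *\<^sub>v v = 0\<^sub>v n \<longrightarrow> v = 0\<^sub>v nc"
    then have "lin_indpt (set (cols A))"
      using lin_depE[OF A _ True] by metis
    then show "rank A = nc"
      using lin_indpt_full_rank[OF A True] by simp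
  qed
next
  case False
  \<comment> \<open>The rank is the size of a maximal independent subset of the set of columns, and
    a repetition leaves fewer than \<open>nc\<close> elements in that set.\<close>
  obtain S where S: "maximal S (\<lambda>T. T \<subseteq> set (cols A) \<and> lin_indpt T)"
    using maximal_exists[of "\<lambda>T. T \<subseteq> set (cols A) \<and> lin_indpt T" "card (set (cols A))" "{}"]
    by (meson List.finite_set card_mono empty_iff empty_subsetI finite_lin_indpt2 rev_finite_subset)
  then have "card S \<le> card (set (cols A))"
    by (simp add: card_mono maximal_def)
  also have "\<dots> < nc"
    using False A by (metis card_distinct card_length carrier_matD(2) cols_length nat_less_le)
  finally have "rank A \<noteq> nc"
    using rank_card_indpt[OF A S] by simp
  moreover obtain i j where ij: "i \<noteq> j" "col A i = col A j" "i < nc" "j < nc"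
    using False A by (auto simp: distinct_conv_nth)
  \<comment> \<open>Two equal columns at different positions give this nonzero kernel
    vector.\<close>
  define v :: "'a vec" where "v = unit_vec nc i - unit_vec nc j"
  have "v \<in> carrier_vec nc"
    by (simp add: v_def)
  moreover have "A *\<^sub>v v = 0\<^sub>v n"
  proof (rule eq_vecI)
    fix k assume "k < dim_vec (0\<^sub>v n)"
    then have "k < n" by simp
    have "A $$ (k, i) = col A i $ k" "A $$ (k, j) = col A j $ k"
      using A ij(3,4) \<open>k < n\<close> by simp_all
    then have "A $$ (k, i) = A $$ (k, j)"
      using ij(2) by metis
    then show "(A *\<^sub>v v) $ k = 0\<^sub>v n $ k"
      using A ij(3,4) \<open>k < n\<close> by (simp add: v_def scalar_prod_minus_distrib[of _ nc])
  qed (use A in simp)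
  moreover have "v \<noteq> 0\<^sub>v nc"
  proof
    assume "v = 0\<^sub>v nc"
    then have "v $ i = 0" using ij by simp
    then show False using ij by (simp add: v_def)
  qed
  ultimately show ?thesis by blast
qed

text \<open>A left inverse \<open>E'\<close> of \<open>E\<close> makes the kernel of
  \<open>E * A\<close> lie in the kernel of \<open>A\<close>, which full rank makes trivial.\<close>

lemma (in vec_space) full_rank_mult_invertible:
  assumes A: "A \<in> carrier_mat n nc" and E: "E \<in> carrier_mat n n" and E': "E' \<in> carrier_mat n n"
    and inv: "E' * E = 1\<^sub>m n" and "rank A = nc"
  shows "rank (E * A) = nc"
proof -
  have "v = 0\<^sub>v nc" if v: "v \<in> carrier_vec nc" and "(E * A) *\<^sub>v v = 0\<^sub>v n" for v
  proof -
    have "A *\<^sub>v v = (E' * E) *\<^sub>v (A *\<^sub>v v)"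
      using A v inv by simp
    also have "\<dots> = E' *\<^sub>v ((E * A) *\<^sub>v v)"
      using A E E' v
      by (metis assoc_mult_mat_vec mult_mat_vec_carrier)
    also have "\<dots> = 0\<^sub>v n"
      using E' that(2) by (auto intro!: eq_vecI)
    finally show ?thesis
      using \<open>rank A = nc\<close> rank_eq_dim_col_iff[OF A] v by blast
  qed
  then show ?thesis
    using rank_eq_dim_col_iff[of "E * A" nc] A E by (metis mult_carrier_mat)
qed

section \<open>Sign change of the last predictor\<close>

text \<open>Numbering from 0, the last of the \<open>J - 1\<close> predictors has index
  \<open>J - 2\<close>.\<close>

definition last_sign :: "nat \<Rightarrow> nat \<Rightarrow> real" where
  "last_sign J j = (if j = J - 2 then - 1 else 1)"

definition negate_last :: "nat \<Rightarrow> (real vec \<Rightarrow> real mat) \<Rightarrow> real vec \<Rightarrow> real mat" where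
  "negate_last J Z x = mat_diag (J - 1) (last_sign J) * Z x"

lemma last_sign_square [simp]: "last_sign J j * last_sign J j = 1"
  by (simp add: last_sign_def)

lemma complete_design_carrier:
  "complete_design J p x \<in> carrier_mat (J - 1) ((J - 1) * (1 + p))"
  by (simp add: complete_design_def)

text \<open>Row \<open>i\<close> of the complete design is nonzero only in the column of its
  intercept and in its own block of \<open>p\<close> slope columns. Scaling the row is thus scaling
  these columns; the index passed to \<open>s\<close> on the right is the row to which column
  \<open>k\<close> belongs.\<close>

lemma mat_diag_mult_complete_design:
  fixes s :: "nat \<Rightarrow> real"
  shows "mat_diag (J - 1) s * complete_design J p x = complete_design J p x *
    mat_diag ((J - 1) * (1 + p)) (\<lambda>k. s (if k < J - 1 then k else (k - (J - 1)) div p))"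
  by (subst mat_diag_mult_left[OF complete_design_carrier],
      subst mat_diag_mult_right[OF complete_design_carrier])
     (auto simp: complete_design_def intro!: eq_matI)

lemma designs_carrier:
  assumes "Z \<in> designs J p"
  shows "\<exists>q. \<forall>x. Z x \<in> carrier_mat (J - 1) q"
proof -
  obtain q C where "C \<in> carrier_mat ((J - 1) * (1 + p)) q" and Z: "Z = (\<lambda>x. complete_design J p x * C)"
    using assms unfolding designs_def by blast
  then have "Z x \<in> carrier_mat (J - 1) q" for x
    unfolding Z by (intro mult_carrier_mat[OF complete_design_carrier])
  then show ?thesis by blast
qed

lemma negate_last_involutive:
  assumes "Z \<in> designs J p"
  shows "negate_last J (negate_last J Z) = Z"
proof -
  obtain q where Z: "\<And>x. Z x \<in> carrier_mat (J - 1) q"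
    using designs_carrier[OF assms] by blast
  show ?thesis
  proof
    fix x
    have "negate_last J (negate_last J Z) x =
        mat_diag (J - 1) (last_sign J) * mat_diag (J - 1) (last_sign J) * Z x"
      unfolding negate_last_def by (rule assoc_mult_mat[OF mat_diag_dim mat_diag_dim Z, symmetric])
    then show "negate_last J (negate_last J Z) x = Z x"
      using Z[of x] by simp
  qed
qed

text \<open>The sign matrix passes through the complete design and is absorbed into \<open>C\<close>
  as an invertible left factor, so the number of columns and the full rank are kept.\<close>

lemma negate_last_designs:
  assumes "Z \<in> designs J p"
  shows "negate_last J Z \<in> designs J p"
proof -
  define N where "N = (J - 1) * (1 + p)"
  obtain q C where q: "J - 1 + p \<le> q" "q \<le> N" and C: "C \<in> carrier_mat N q"
    and rank: "vec_space.rank N C = q" and Z: "Z = (\<lambda>x. complete_design J p x * C)"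
    using assms unfolding designs_def N_def by auto
  \<comment> \<open>\<open>E\<close> changes the sign of the intercept and of the slopes of the last
    predictor; being diagonal with entries 1 and -1, it is its own inverse.\<close>
  define E where "E = mat_diag N (\<lambda>k. last_sign J (if k < J - 1 then k else (k - (J - 1)) div p))"
  have E: "E \<in> carrier_mat N N" and EE: "E * E = 1\<^sub>m N"
    by (simp_all add: E_def)
  have design: "complete_design J p x \<in> carrier_mat (J - 1) N" for x
    unfolding N_def by (rule complete_design_carrier)
  have "negate_last J Z x = complete_design J p x * (E * C)" for x
  proof -
    have "negate_last J Z x = mat_diag (J - 1) (last_sign J) * complete_design J p x * C"
      unfolding negate_last_def Z by (rule assoc_mult_mat[OF mat_diag_dim design C, symmetric])
    also have "\<dots> = complete_design J p x * E * C"
      by (simp only: mat_diag_mult_complete_design E_def N_def)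
    also have "\<dots> = complete_design J p x * (E * C)"
      by (rule assoc_mult_mat[OF design E C])
    finally show ?thesis .
  qed
  moreover have "E * C \<in> carrier_mat N q"
    using E C by simp
  moreover have "vec_space.rank N (E * C) = q"
    by (rule vec_space.full_rank_mult_invertible[OF C E E EE rank])
  ultimately show ?thesis
    using q unfolding designs_def N_def by blast
qed

section \<open>Category probabilities under the transposition\<close>

lemma sum_cat_prob: "(\<Sum>k<J. cat_prob J \<pi> k) = 1" if "J \<ge> 1"
proof -
  obtain m where "J = Suc m" using \<open>J \<ge> 1\<close> by (cases J) auto
  then show ?thesis by (simp add: cat_prob_def)
qed

lemma cat_prob_pos: "\<pi> \<in> prob_vecs J \<Longrightarrow> 0 < cat_prob J \<pi> j"
  by (auto simp: prob_vecs_def cat_prob_def)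

text \<open>Every tail starting at \<open>J - 2\<close> or earlier contains both exchanged indices,
  so the transposition permutes it. This keeps the denominators of the sequential ratio
  fixed.\<close>

lemma sum_transpose_last:
  fixes f :: "nat \<Rightarrow> real"
  assumes "J \<ge> 2" and "j < J - 1"
  shows "(\<Sum>k=j..<J. f (Transposition.transpose (J - 2) (J - 1) k)) = (\<Sum>k=j..<J. f k)"
proof -
  have "bij_betw (Transposition.transpose (J - 2) (J - 1)) {j..<J} {j..<J}"
    using assms by (intro bij_betw_byWitness[where f' = "Transposition.transpose (J - 2) (J - 1)"])
      (auto simp: Transposition.transpose_def)
  then show ?thesis by (rule sum.reindex_bij_betw)
qed

text \<open>For the first \<open>J - 1\<close> categories this is the definition. The last
  probability is only given as a complement, and it has the right value because the permuted
  probabilities still sum to 1.\<close>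

lemma cat_prob_permute_probs:
  assumes "J \<ge> 2" and "j < J"
  shows "cat_prob J (permute_probs J (Transposition.transpose (J - 2) (J - 1)) \<pi>) j =
    cat_prob J \<pi> (Transposition.transpose (J - 2) (J - 1) j)"
proof (cases "j < J - 1")
  case True
  then show ?thesis by (simp add: cat_prob_def permute_probs_def)
next
  case False
  let ?\<tau> = "Transposition.transpose (J - 2) (J - 1)"
  from False assms have j: "j = J - 1" by simp
  have "(\<Sum>k<J. cat_prob J \<pi> (?\<tau> k)) = 1"
    using sum_transpose_last[of J 0 "cat_prob J \<pi>"] sum_cat_prob[of J \<pi>] assms
    by (simp add: atLeast0LessThan)
  moreover have "{..<J} = insert (J - 1) {..<J - 1}"
    using assms by auto
  ultimately have "cat_prob J \<pi> (?\<tau> (J - 1)) = 1 - (\<Sum>k<J - 1. cat_prob J \<pi> (?\<tau> k))"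
    by simp
  moreover have "cat_prob J (permute_probs J ?\<tau> \<pi>) (J - 1) = 1 - (\<Sum>k<J - 1. cat_prob J \<pi> (?\<tau> k))"
    unfolding cat_prob_def[of J "permute_probs J ?\<tau> \<pi>"] by (simp add: permute_probs_def)
  ultimately show ?thesis using j by metis
qed

text \<open>Everything follows from the positivity of all \<open>J\<close> probabilities: for the
  last category it says that the coordinates sum to less than 1, and each positive coordinate is at
  most that sum.\<close>

lemma permute_probs_prob_vecs:
  assumes "J \<ge> 3" and \<pi>: "\<pi> \<in> prob_vecs J"
  shows "permute_probs J (Transposition.transpose (J - 2) (J - 1)) \<pi> \<in> prob_vecs J"
proof -
  let ?\<rho> = "permute_probs J (Transposition.transpose (J - 2) (J - 1)) \<pi>"
  have car: "?\<rho> \<in> carrier_vec (J - 1)"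
    by (simp add: permute_probs_def)
  have pos: "0 < cat_prob J ?\<rho> j" if "j < J" for j
    using cat_prob_permute_probs[of J j \<pi>] cat_prob_pos[OF \<pi>] assms that by simp
  have coord: "0 < ?\<rho> $ j" if "j < J - 1" for j
    using pos[of j] that unfolding cat_prob_def[of J ?\<rho>] by simp
  have sum: "(\<Sum>j<J - 1. ?\<rho> $ j) < 1"
    using pos[of "J - 1"] assms unfolding cat_prob_def[of J ?\<rho>] by simp
  have "?\<rho> $ j < 1" if "j < J - 1" for j
    using member_le_sum[of j "{..<J - 1}" "\<lambda>j. ?\<rho> $ j"] coord sum that
    by (force intro: less_imp_le)
  with car coord sum show ?thesis
    by (simp add: prob_vecs_def)
qed

lemma permute_probs_involutive:
  assumes "J \<ge> 2" and "\<pi> \<in> prob_vecs J"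
  shows "permute_probs J (Transposition.transpose (J - 2) (J - 1))
    (permute_probs J (Transposition.transpose (J - 2) (J - 1)) \<pi>) = \<pi>"
proof (rule eq_vecI)
  let ?\<tau> = "Transposition.transpose (J - 2) (J - 1)"
  fix j assume "j < dim_vec \<pi>"
  then have j: "j < J - 1" using assms by (auto simp: prob_vecs_def)
  then have "?\<tau> j < J" using assms by (auto simp: Transposition.transpose_def)
  then show "permute_probs J ?\<tau> (permute_probs J ?\<tau> \<pi>) $ j = \<pi> $ j"
    using j cat_prob_permute_probs[of J "?\<tau> j" \<pi>] assms
    by (simp add: permute_probs_def[of _ _ "permute_probs _ _ _"]) (simp add: cat_prob_def)
qed (use assms in \<open>auto simp: permute_probs_def prob_vecs_def\<close>)

section \<open>The sequential ratio under the transposition\<close>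

definition complement_last :: "nat \<Rightarrow> real vec \<Rightarrow> real vec" where
  "complement_last J u = vec (J - 1) (\<lambda>j. if j = J - 2 then 1 - u $ j else u $ j)"

lemma complement_last_involutive:
  "u \<in> carrier_vec (J - 1) \<Longrightarrow> complement_last J (complement_last J u) = u"
  by (auto simp: complement_last_def)

text \<open>The denominators are invariant tail sums, and the numerators before index
  \<open>J - 2\<close> are fixed. At \<open>J - 2\<close> the numerator becomes the last
  probability; the old and the new ratio share the denominator and add up to 1.\<close>

lemma sequential_permute_probs:
  assumes "J \<ge> 3" and \<pi>: "\<pi> \<in> prob_vecs J"
  shows "sequential J (permute_probs J (Transposition.transpose (J - 2) (J - 1)) \<pi>) =
    complement_last J (sequential J \<pi>)"
proof (rule eq_vecI)
  let ?\<tau> = "Transposition.transpose (J - 2) (J - 1)"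
  fix j assume "j < dim_vec (complement_last J (sequential J \<pi>))"
  then have j: "j < J - 1" by (simp add: complement_last_def)
  define \<rho> where "\<rho> = permute_probs J ?\<tau> \<pi>"
  have \<rho>: "cat_prob J \<rho> k = cat_prob J \<pi> (?\<tau> k)" if "k < J" for k
    unfolding \<rho>_def using assms that by (intro cat_prob_permute_probs) auto
  have "(\<Sum>k=j..<J. cat_prob J \<rho> k) = (\<Sum>k=j..<J. cat_prob J \<pi> (?\<tau> k))"
    by (intro sum.cong refl \<rho>) simp
  also have "\<dots> = (\<Sum>k=j..<J. cat_prob J \<pi> k)"
    using assms j by (intro sum_transpose_last) auto
  finally have "(\<Sum>k=j..<J. cat_prob J \<rho> k) = (\<Sum>k=j..<J. cat_prob J \<pi> k)" .
  moreover have "sequential J \<rho> $ j = cat_prob J \<rho> j / (\<Sum>k=j..<J. cat_prob J \<rho> k)"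
    using j by (simp add: sequential_def)
  ultimately have lhs: "sequential J (permute_probs J ?\<tau> \<pi>) $ j =
      cat_prob J \<pi> (?\<tau> j) / (\<Sum>k=j..<J. cat_prob J \<pi> k)"
    using j \<rho>[of j] by (simp add: \<rho>_def)
  show "sequential J (permute_probs J ?\<tau> \<pi>) $ j = complement_last J (sequential J \<pi>) $ j"
  proof (cases "j = J - 2")
    case True
    \<comment> \<open>The last denominator consists of just the two exchanged probabilities; it is
      nonzero, so the fractions can be cleared.\<close>
    have "{J - 2..<J} = {J - 2, J - 1}" using assms by auto
    then have "(\<Sum>k=j..<J. cat_prob J \<pi> k) = cat_prob J \<pi> (J - 2) + cat_prob J \<pi> (J - 1)"
      using True assms by simp
    moreover have "cat_prob J \<pi> (J - 2) + cat_prob J \<pi> (J - 1) \<noteq> 0"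
      using cat_prob_pos[OF \<pi>, of "J - 2"] cat_prob_pos[OF \<pi>, of "J - 1"] by linarith
    ultimately show ?thesis
      using lhs j True by (simp add: complement_last_def sequential_def field_simps)
  next
    case False
    then have "?\<tau> j = j" using j by (simp add: Transposition.transpose_def)
    then show ?thesis using lhs j False by (simp add: complement_last_def sequential_def)
  qed
qed (simp add: complement_last_def sequential_def)

text \<open>If \<open>u\<close> is the ratio of \<open>\<pi>\<close>, its complement is the ratio of
  the permuted \<open>\<pi>\<close>. The converse is the same implication applied to
  \<open>complement_last J u\<close>, by involution.\<close>

lemma complement_last_sequential_range:
  assumes "J \<ge> 3" and u: "u \<in> carrier_vec (J - 1)"
  shows "complement_last J u \<in> sequential J ` prob_vecs J \<longleftrightarrow> u \<in> sequential J ` prob_vecs J"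
proof -
  have "complement_last J v \<in> sequential J ` prob_vecs J"
    if *: "v \<in> sequential J ` prob_vecs J" for v
  proof -
    obtain \<pi> where \<pi>: "\<pi> \<in> prob_vecs J" and v: "v = sequential J \<pi>"
      using * by blast
    show ?thesis
      unfolding v sequential_permute_probs[OF assms(1) \<pi>, symmetric]
      by (rule imageI[OF permute_probs_prob_vecs[OF assms(1) \<pi>]])
  qed
  from this[of u] this[of "complement_last J u"] show ?thesis
    using complement_last_involutive[OF u] by auto
qed

section \<open>Predictors and parameter spaces\<close>

lemma negate_last_mult_vec:
  assumes "Z x \<in> carrier_mat (J - 1) q" and "\<beta> \<in> carrier_vec q" and "j < J - 1"
  shows "(negate_last J Z x *\<^sub>v \<beta>) $ j = last_sign J j * (Z x *\<^sub>v \<beta>) $ j"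
  using assms unfolding negate_last_def mat_diag_mult_left[of "Z x", OF assms(1)]
  by (simp add: scalar_prod_def sum_distrib_left mult.assoc)

text \<open>Oriented so that rewriting removes the minus sign; the equation in
  \<open>symmetric_cdfs\<close> would rewrite forever.\<close>

lemma symmetric_cdf_uminus:
  assumes "F \<in> symmetric_cdfs"
  shows "F (- w) = 1 - F w"
proof -
  have "F w = 1 - F (- w)"
    using assms unfolding symmetric_cdfs_def by blast
  then show ?thesis by linarith
qed

text \<open>The symmetry of \<open>F\<close> links the two actions: a sign change of the last
  predictor is a complement of the last ratio.\<close>

lemma map_cdf_negate_last:
  assumes F: "F \<in> symmetric_cdfs" and Z: "Z x \<in> carrier_mat (J - 1) q"
    and \<beta>: "\<beta> \<in> carrier_vec q"
  shows "map_vec F (negate_last J Z x *\<^sub>v \<beta>) = complement_last J (map_vec F (Z x *\<^sub>v \<beta>))"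
proof (rule eq_vecI)
  fix j assume "j < dim_vec (complement_last J (map_vec F (Z x *\<^sub>v \<beta>)))"
  then have j: "j < J - 1" by (simp add: complement_last_def)
  have "dim_vec (negate_last J Z x *\<^sub>v \<beta>) = J - 1"
    by (simp add: negate_last_def mat_diag_def)
  then have "map_vec F (negate_last J Z x *\<^sub>v \<beta>) $ j = F (last_sign J j * (Z x *\<^sub>v \<beta>) $ j)"
    using j negate_last_mult_vec[of Z x J q \<beta> j] Z \<beta> by simp
  then show "map_vec F (negate_last J Z x *\<^sub>v \<beta>) $ j =
      complement_last J (map_vec F (Z x *\<^sub>v \<beta>)) $ j"
    using j Z by (simp add: complement_last_def last_sign_def symmetric_cdf_uminus[OF F])
qed (simp add: complement_last_def negate_last_def mat_diag_def)

text \<open>Both conditions on the predictor are invariant: the open support of a symmetric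
  \<open>F\<close> is symmetric about 0, and the range of the ratio is closed under
  \<open>complement_last\<close>.\<close>

lemma param_space_negate_last:
  assumes J: "J \<ge> 3" and F: "F \<in> symmetric_cdfs" and Z: "Z \<in> designs J p"
  shows "param_space J X (sequential J, F, negate_last J Z) = param_space J X (sequential J, F, Z)"
proof -
  obtain q where car: "\<And>x. Z x \<in> carrier_mat (J - 1) q"
    using designs_carrier[OF Z] by blast
  have dim: "dim_col (negate_last J Z x) = q" "dim_col (Z x) = q" for x
    using car[of x] by (simp_all add: negate_last_def)
  have supp: "last_sign J j * w \<in> open_support F \<longleftrightarrow> w \<in> open_support F" for j w
    by (auto simp: last_sign_def open_support_def symmetric_cdf_uminus[OF F])
  have support: "(negate_last J Z x *\<^sub>v \<beta>) $ j \<in> open_support F \<longleftrightarrow> (Z x *\<^sub>v \<beta>) $ j \<in> open_support F"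
    if "\<beta> \<in> carrier_vec q" "j < J - 1" for x \<beta> j
    unfolding negate_last_mult_vec[of Z x J q \<beta> j, OF car that]
    by (rule supp)
  have ratios: "map_vec F (negate_last J Z x *\<^sub>v \<beta>) \<in> sequential J ` prob_vecs J \<longleftrightarrow>
      map_vec F (Z x *\<^sub>v \<beta>) \<in> sequential J ` prob_vecs J" if "\<beta> \<in> carrier_vec q" for x \<beta>
  proof -
    have "map_vec F (Z x *\<^sub>v \<beta>) \<in> carrier_vec (J - 1)"
      using car[of x] by (intro carrier_vecI) simp
    then show ?thesis
      unfolding map_cdf_negate_last[of F Z x J q \<beta>, OF F car that]
      by (rule complement_last_sequential_range[OF J])
  qed
  show ?thesis
    unfolding param_space_def prod.case dim
    by (intro Collect_cong ball_cong refl conj_cong all_cong1 imp_cong support ratios)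
qed

section \<open>Equality of models and stability\<close>

text \<open>Applying \<open>complement_last\<close> to both sides turns the equation that defines
  \<open>\<pi>\<close> in one model into that of the other.\<close>

lemma permuted_model_eq_model_negate_last:
  assumes J: "J \<ge> 3" and F: "F \<in> symmetric_cdfs" and Z: "Z \<in> designs J p"
  shows "permuted_model J X (Transposition.transpose (J - 2) (J - 1)) (sequential J, F, Z) =
    model J X (sequential J, F, negate_last J Z)"
proof -
  let ?\<tau> = "Transposition.transpose (J - 2) (J - 1)"
  obtain q where car: "\<And>x. Z x \<in> carrier_mat (J - 1) q"
    using designs_carrier[OF Z] by blast
  have step: "sequential J (permute_probs J ?\<tau> \<pi>) = map_vec F (Z x *\<^sub>v \<beta>) \<longleftrightarrow>
      sequential J \<pi> = map_vec F (negate_last J Z x *\<^sub>v \<beta>)"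
    if \<pi>: "\<pi> \<in> prob_vecs J" and \<beta>: "\<beta> \<in> carrier_vec q" for \<pi> x \<beta>
  proof -
    have "sequential J \<pi> \<in> carrier_vec (J - 1)" "map_vec F (Z x *\<^sub>v \<beta>) \<in> carrier_vec (J - 1)"
      using car[of x] by (auto simp: sequential_def intro!: carrier_vecI)
    note involutive = this[THEN complement_last_involutive]
    show ?thesis
      unfolding sequential_permute_probs[OF J \<pi>] map_cdf_negate_last[of F Z x J q \<beta>, OF F car \<beta>]
      using involutive by metis
  qed
  \<comment> \<open>The predicates under the two descriptions coincide for every
    \<open>\<pi>\<close>, hence so do the described values.\<close>
  have same: "(THE \<pi>. \<pi> \<in> prob_vecs J \<and> sequential J (permute_probs J ?\<tau> \<pi>) = map_vec F (Z x *\<^sub>v \<beta>)) =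
      (THE \<pi>. \<pi> \<in> prob_vecs J \<and> sequential J \<pi> = map_vec F (negate_last J Z x *\<^sub>v \<beta>))"
    if "x \<in> X" "\<beta> \<in> param_space J X (sequential J, F, Z)" for x \<beta>
  proof -
    have "\<beta> \<in> carrier_vec (dim_col (Z x))"
      using that unfolding param_space_def prod.case by blast
    then have "\<beta> \<in> carrier_vec q"
      by (simp only: carrier_matD(2)[OF car])
    then show ?thesis
      by (intro arg_cong[of _ _ The] ext conj_cong refl step)
  qed
  \<comment> \<open>The parameter spaces agree, so both maps are restricted to the same set and need
    comparison only there.\<close>
  show ?thesis
    unfolding permuted_model_def model_def prod.case param_space_negate_last[OF assms]
    by (intro arg_cong2[of _ _ _ _ Pair] refl restrict_ext)
      (simp only: mem_Sigma_iff split_paired_all prod.case same)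
qed

theorem corollary9:
  fixes J p :: nat and X :: "real vec set"
  assumes "J \<ge> 3" and "p \<ge> 1" and "X \<subseteq> carrier_vec p" and "X \<noteq> {}"
  shows "stable_under J X (Transposition.transpose (J - 2) (J - 1))
           {(sequential J, F, Z) | F Z. F \<in> symmetric_cdfs \<and> Z \<in> designs J p}"
proof -
  let ?S = "{(sequential J, F, Z) | F Z. F \<in> symmetric_cdfs \<and> Z \<in> designs J p}"
  let ?\<tau> = "Transposition.transpose (J - 2) (J - 1)"
  have "permuted_model J X ?\<tau> (sequential J, F, Z) \<in> model J X ` ?S"
    if "F \<in> symmetric_cdfs" "Z \<in> designs J p" for F Z
    unfolding permuted_model_eq_model_negate_last[OF assms(1) that]
    using that negate_last_designs by blast
  \<comment> \<open>For the reverse inclusion the witness is the sign-changed design: permuting its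
    model changes the sign a second time and gives back \<open>Z\<close>.\<close>
  moreover have "model J X (sequential J, F, Z) \<in> permuted_model J X ?\<tau> ` ?S"
    if "F \<in> symmetric_cdfs" "Z \<in> designs J p" for F Z
  proof (rule image_eqI)
    show "model J X (sequential J, F, Z) =
        permuted_model J X ?\<tau> (sequential J, F, negate_last J Z)"
      using permuted_model_eq_model_negate_last[OF assms(1) that(1) negate_last_designs[OF that(2)]]
      by (simp add: negate_last_involutive[OF that(2)])
    show "(sequential J, F, negate_last J Z) \<in> ?S"
      using that negate_last_designs by blast
  qed
  ultimately show ?thesis
    unfolding stable_under_def by auto
qed

end
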